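(* Let $G$ be a finite abstract simplicial complex. Let $L$ be the matrix indexed by $G\times G$ with $L(x,y)=1$ if $x\cap y\neq\emptyset$ and $L(x,y)=0$ otherwise, and let $g$ be the matrix indexed by $G\times G$ with $g(x,y)=\omega(x)\,\omega(y)\,\chi(U(x)\cap U(y))$. Then $L$ is invertible and $L^{-1}=g$.
   Context: A finite abstract simplicial complex $G$ is a finite set of non-empty finite sets closed under taking non-empty subsets. For $x\in G$, $\dim(x)=|x|-1$, $\omega(x)=(-1)^{\dim(x)}$, and the star of $x$ is $U(x)=\{y\in G: x\subset y\}$ (inclusion not necessarily strict). For any subset $A\subset G$, $\chi(A)=\sum_{x\in A}\omega(x)$. *)

theory Defs
  imports "Jordan_Normal_Form.Matrix"
begin

definition finite_abstract_simplicial_complex :: "'v set set \<Rightarrow> bool" where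
  "finite_abstract_simplicial_complex G \<longleftrightarrow>
     finite G \<and>
     (\<forall>x\<in>G. finite x \<and> x \<noteq> {}) \<and>
     (\<forall>x\<in>G. \<forall>y. y \<subseteq> x \<and> y \<noteq> {} \<longrightarrow> y \<in> G)"

(* Natural-number subtraction is harmless here: simplices are finite and non-empty. *)
definition simplex_dim :: "'v set \<Rightarrow> nat" where
  "simplex_dim x = card x - 1"

definition omega :: "'v set \<Rightarrow> int" where
  "omega x = (- 1) ^ simplex_dim x"

definition star :: "'v set set \<Rightarrow> 'v set \<Rightarrow> 'v set set" where
  "star G x = {y \<in> G. x \<subseteq> y}"

definition euler_char :: "'v set set \<Rightarrow> int" where
  "euler_char A = (\<Sum>x\<in>A. omega x)"

(* A matrix indexed by G x G is represented through a list xs that enumerates G without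
   repetition: row i and column j belong to the simplices xs ! i and xs ! j. *)
definition connection_matrix :: "'v set list \<Rightarrow> int mat" where
  "connection_matrix xs =
     mat (length xs) (length xs) (\<lambda>(i, j). if xs ! i \<inter> xs ! j \<noteq> {} then 1 else 0)"

definition green_matrix :: "'v set set \<Rightarrow> 'v set list \<Rightarrow> int mat" where
  "green_matrix G xs =
     mat (length xs) (length xs)
       (\<lambda>(i, j). omega (xs ! i) * omega (xs ! j) *
                 euler_char (star G (xs ! i) \<inter> star G (xs ! j)))"

end

theory Submission
  imports Defs
begin

text \<open>
  Exchanging sums, the entry of \<open>L g\<close> at \<open>(x, z)\<close> is \<open>\<omega>(z)\<close> times the sum, over the simplices
  \<open>w\<close> containing \<open>z\<close>, of \<open>\<omega>(w)\<close> times the sum of \<open>\<omega>(y)\<close> over the faces \<open>y\<close> of \<open>w\<close> that meet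
  \<open>x\<close>. By the vanishing of alternating sums over nontrivial Boolean intervals, the inner sum is \<open>1\<close>
  if \<open>w\<close> is contained in \<open>x\<close> and \<open>0\<close> otherwise, so what remains is an alternating sum over the
  interval from \<open>z\<close> to \<open>x\<close>, which vanishes unless \<open>z = x\<close>. As \<open>L\<close> and \<open>g\<close> are symmetric, \<open>g L\<close>
  is the identity as well.
\<close>

lemma omega_eq:
  assumes "finite x" "x \<noteq> {}"
  shows "omega x = - ((-1) ^ card x)"
proof -
  obtain n where "card x = Suc n"
    using assms by (metis card_eq_0_iff not0_implies_Suc)
  then show ?thesis
    by (simp add: omega_def simplex_dim_def)
qed

lemma omega_square: "omega x * omega x = 1"
  by (simp add: omega_def flip: power_add)

text \<open>Toggling a fixed element of \<open>B - A\<close> pairs the sets of even cardinality in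
  the interval with those of odd cardinality.\<close>

lemma sum_interval_alternating:
  assumes "finite B" "A \<subset> B"
  shows "(\<Sum>w | A \<subseteq> w \<and> w \<subseteq> B. (-1) ^ card w) = (0::int)"
proof (rule sum_alternating_cancels)
  show "finite {w. A \<subseteq> w \<and> w \<subseteq> B}"
    using assms(1) by (auto intro: finite_subset[of _ "Pow B"])
  show "card {w \<in> {w. A \<subseteq> w \<and> w \<subseteq> B}. even (card w)} =
      card {w \<in> {w. A \<subseteq> w \<and> w \<subseteq> B}. odd (card w)}"
    using card_subsupersets_even_odd[OF assms] by (simp add: conj_commute conj_left_commute)
qed

text \<open>As \<open>z\<close> is nonempty, so is every \<open>w\<close> above it; hence
  \<open>omega w\<close> is minus the sign of \<open>card w\<close>, and the sum cancels on a proper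
  interval.\<close>

lemma sum_omega_interval:
  assumes "finite x" "z \<noteq> {}"
  shows "(\<Sum>w | z \<subseteq> w \<and> w \<subseteq> x. omega w) = (if z = x then omega x else 0)"
proof (cases "z \<subset> x")
  case True
  have "omega w = - ((-1) ^ card w)" if "w \<in> {w. z \<subseteq> w \<and> w \<subseteq> x}" for w
    using that assms by (intro omega_eq) (auto dest: finite_subset)
  then have "(\<Sum>w | z \<subseteq> w \<and> w \<subseteq> x. omega w) = - (\<Sum>w | z \<subseteq> w \<and> w \<subseteq> x. (-1) ^ card w)"
    by (simp add: sum_negf)
  with True sum_interval_alternating[OF assms(1) True] show ?thesis by auto
next
  case False
  then have "{w. z \<subseteq> w \<and> w \<subseteq> x} = (if z = x then {x} else {})" by auto
  then show ?thesis by simp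
qed

lemma sum_omega_nonempty_subsets:
  assumes "finite w"
  shows "(\<Sum>y | y \<noteq> {} \<and> y \<subseteq> w. omega y) = (if w = {} then 0 else 1)"
proof (cases "w = {}")
  case True
  then have "{y. y \<noteq> {} \<and> y \<subseteq> w} = {}" by auto
  with True show ?thesis by simp
next
  case False
  have "omega y = - ((-1) ^ card y)" if "y \<in> {y. y \<noteq> {} \<and> y \<subseteq> w}" for y
    using that assms by (intro omega_eq) (auto dest: finite_subset)
  then have "(\<Sum>y | y \<noteq> {} \<and> y \<subseteq> w. omega y) = - (\<Sum>y | y \<noteq> {} \<and> y \<subseteq> w. (-1) ^ card y)"
    by (simp add: sum_negf)
  \<comment> \<open>The sum over all of \<open>Pow w\<close> vanishes, so only the removed term of
    the empty set, equal to 1, survives.\<close>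
  also have "(\<Sum>y | y \<noteq> {} \<and> y \<subseteq> w. (-1) ^ card y) = (\<Sum>y \<in> Pow w - {{}}. (-1::int) ^ card y)"
    by (rule sum.cong) auto
  also have "\<dots> = (\<Sum>y \<in> Pow w. (-1) ^ card y) - 1"
    using assms by (simp add: sum_diff1)
  also have "(\<Sum>y \<in> Pow w. (-1::int) ^ card y) = 0"
    using sum_interval_alternating[OF assms, of "{}"] False by (auto simp: Pow_def)
  finally show ?thesis
    using False by simp
qed

text \<open>The nonempty subsets of \<open>w\<close> that miss \<open>x\<close> are those of
  \<open>w - x\<close>. Removing their sum from the total 1 leaves 0, unless \<open>w - x\<close> is
  empty.\<close>

lemma sum_omega_meeting_subsets:
  assumes "finite w" "w \<noteq> {}"
  shows "(\<Sum>y | y \<subseteq> w \<and> x \<inter> y \<noteq> {}. omega y) = (if w \<subseteq> x then 1 else 0)"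
proof -
  let ?M = "{y. y \<subseteq> w \<and> x \<inter> y \<noteq> {}}"
  let ?D = "{y. y \<noteq> {} \<and> y \<subseteq> w - x}"
  have "finite ?M" "finite ?D"
    using assms(1) by (auto intro: finite_subset[of _ "Pow w"])
  moreover have "{y. y \<noteq> {} \<and> y \<subseteq> w} = ?M \<union> ?D" "?M \<inter> ?D = {}"
    by auto
  ultimately have "sum omega {y. y \<noteq> {} \<and> y \<subseteq> w} = sum omega ?M + sum omega ?D"
    by (simp only: sum.union_disjoint)
  then show ?thesis
    using assms sum_omega_nonempty_subsets[of w] sum_omega_nonempty_subsets[of "w - x"]
    by (auto split: if_splits)
qed

text \<open>This is the matrix product entry in row \<open>x\<close> and column \<open>z\<close>,
  written over \<open>G\<close> without list indices.\<close>

lemma sum_connection_green: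
  assumes G: "finite_abstract_simplicial_complex G" and x: "x \<in> G" and z: "z \<in> G"
  shows "(\<Sum>y\<in>G. (if x \<inter> y \<noteq> {} then 1 else 0) *
            (omega y * omega z * euler_char (star G y \<inter> star G z))) = (if x = z then 1 else 0)"
proof -
  have fin: "finite G" and simplex: "\<And>w. w \<in> G \<Longrightarrow> finite w \<and> w \<noteq> {}"
    and face: "\<And>w y. w \<in> G \<Longrightarrow> y \<subseteq> w \<Longrightarrow> y \<noteq> {} \<Longrightarrow> y \<in> G"
    using G unfolding finite_abstract_simplicial_complex_def by blast+
  \<comment> \<open>With the conditions moved into the summand, \<open>w\<close> ranges over
    \<open>G\<close> independently of \<open>y\<close>, so the sums can be swapped.\<close>
  have euler: "euler_char (star G y \<inter> star G z) =
      (\<Sum>w\<in>G. if y \<subseteq> w \<and> z \<subseteq> w then omega w else 0)" for y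
    unfolding euler_char_def star_def sum.inter_filter[OF fin, symmetric]
    by (rule sum.cong) auto
  have inner: "(\<Sum>y\<in>G. if y \<subseteq> w \<and> x \<inter> y \<noteq> {} then omega y else 0) = (if w \<subseteq> x then 1 else 0)"
    if "w \<in> G" for w
  proof -
    \<comment> \<open>A set meeting \<open>x\<close> is nonempty, so closure under faces puts it in
      \<open>G\<close>.\<close>
    have "{y \<in> G. y \<subseteq> w \<and> x \<inter> y \<noteq> {}} = {y. y \<subseteq> w \<and> x \<inter> y \<noteq> {}}"
      using face[OF that] by blast
    then show ?thesis
      using sum_omega_meeting_subsets[of w x] simplex[OF that]
      unfolding sum.inter_filter[OF fin, symmetric] by simp
  qed
  have "(\<Sum>y\<in>G. (if x \<inter> y \<noteq> {} then 1 else 0) *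
            (omega y * omega z * euler_char (star G y \<inter> star G z))) =
      (\<Sum>y\<in>G. \<Sum>w\<in>G. omega z * ((if z \<subseteq> w then omega w else 0) *
        (if y \<subseteq> w \<and> x \<inter> y \<noteq> {} then omega y else 0)))"
    unfolding euler sum_distrib_left by (intro sum.cong) auto
  also have "\<dots> = omega z * (\<Sum>w\<in>G. (if z \<subseteq> w then omega w else 0) *
        (\<Sum>y\<in>G. if y \<subseteq> w \<and> x \<inter> y \<noteq> {} then omega y else 0))"
    by (subst sum.swap) (simp only: sum_distrib_left)
  also have "\<dots> = omega z * (\<Sum>w\<in>G. if z \<subseteq> w \<and> w \<subseteq> x then omega w else 0)"
    by (intro arg_cong2[where f = times] sum.cong refl) (auto simp: inner)
  also have "(\<Sum>w\<in>G. if z \<subseteq> w \<and> w \<subseteq> x then omega w else 0) = (\<Sum>w | z \<subseteq> w \<and> w \<subseteq> x. omega w)"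
    unfolding sum.inter_filter[OF fin, symmetric]
    \<comment> \<open>Each \<open>w\<close> between \<open>z\<close> and \<open>x\<close> is a
      nonempty face of \<open>x\<close>, hence in \<open>G\<close>.\<close>
    using face[OF x] simplex[OF z] by (intro sum.cong) auto
  also have "\<dots> = (if z = x then omega x else 0)"
    using simplex[OF x] simplex[OF z] by (simp add: sum_omega_interval)
  finally show ?thesis
    by (auto simp: omega_square)
qed

theorem mainTheorem7:
  fixes G :: "'v set set" and xs :: "'v set list"
  assumes "finite_abstract_simplicial_complex G"
    and "distinct xs" and "set xs = G"
  shows "invertible_mat (connection_matrix xs)
       \<and> inverts_mat (connection_matrix xs) (green_matrix G xs)
       \<and> inverts_mat (green_matrix G xs) (connection_matrix xs)"
proof -
  let ?L = "connection_matrix xs" and ?g = "green_matrix G xs" and ?n = "length xs"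
  have sum_nth: "(\<Sum>k = 0..<?n. f (xs ! k)) = sum f G" for f :: "'v set \<Rightarrow> int"
    using sum.reindex_bij_betw[OF bij_betw_nth[OF assms(2) refl refl], of f] assms(3)
    by (simp add: lessThan_atLeast0)
  have L: "?L \<in> carrier_mat ?n ?n" and g: "?g \<in> carrier_mat ?n ?n"
    by (auto simp: connection_matrix_def green_matrix_def)
  have Lg: "?L * ?g = 1\<^sub>m ?n"
  proof (rule eq_matI)
    fix i j assume "i < dim_row (1\<^sub>m ?n :: int mat)" "j < dim_col (1\<^sub>m ?n :: int mat)"
    then have ij: "i < ?n" "j < ?n" by auto
    then have "(?L * ?g) $$ (i, j) = (\<Sum>k = 0..<?n. (if xs ! i \<inter> xs ! k \<noteq> {} then 1 else 0) *
        (omega (xs ! k) * omega (xs ! j) * euler_char (star G (xs ! k) \<inter> star G (xs ! j))))"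
      by (auto simp: connection_matrix_def green_matrix_def scalar_prod_def intro!: sum.cong)
    also have "\<dots> = (if xs ! i = xs ! j then 1 else 0)"
      unfolding sum_nth[where f = "\<lambda>y. (if xs ! i \<inter> y \<noteq> {} then 1 else 0) *
        (omega y * omega (xs ! j) * euler_char (star G y \<inter> star G (xs ! j)))"]
      using ij assms by (intro sum_connection_green) auto
    also have "\<dots> = 1\<^sub>m ?n $$ (i, j)"
      using ij assms(2) by (simp add: nth_eq_iff_index_eq)
    finally show "(?L * ?g) $$ (i, j) = 1\<^sub>m ?n $$ (i, j)" .
  qed (use L g in auto)
  have "transpose_mat ?L = ?L" "transpose_mat ?g = ?g"
    by (rule eq_matI; auto simp: connection_matrix_def green_matrix_def Int_commute mult.commute)+
  \<comment> \<open>Transposing \<open>?L * ?g\<close> reverses the factors and fixes both of them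
    and the identity.\<close>
  then have gL: "?g * ?L = 1\<^sub>m ?n"
    using transpose_mult[OF L g] Lg by simp
  have "inverts_mat ?L ?g" "inverts_mat ?g ?L"
    using Lg gL L g by (auto simp: inverts_mat_def)
  then show ?thesis
    using L by (auto simp: invertible_mat_def)
qed

end
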